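(* Let $\rho(n)=2^{-n}\sum_{f\in\mathbb{F}_2[x],\ \deg(f)=n}\tau(f)$ and $\rho_0(n)=2^{-n}\sum_{f\in\mathbb{F}_2[x],\ \deg(f)=n}\tau_0(f)$. Then $\lim_{n\to\infty}\frac{\rho(n)}{n}=2$ and $\lim_{n\to\infty}\frac{\rho_0(n)}{n}=3$.
   Context: Define $T:\mathbb{F}_2[x]\to\mathbb{F}_2[x]$ by $T(f)=\frac{f}{x+1}$ if $f(1)=0$ and $T(f)=\frac{xf+1}{x+1}$ if $f(1)=1$. For nonzero $f\in\mathbb{F}_2[x]$, $\tau(f)$ is the least $k\in\mathbb{N}$ with $T^k(f)=1$. Define the polynomial Collatz map $T_0:\mathbb{F}_2[x]\to\mathbb{F}_2[x]$ by $T_0(f)=\frac{f}{x}$ if $f(0)=0$ and $T_0(f)=(x+1)f+1$ if $f(0)=1$; for nonzero $f$, $\tau_0(f)$ is the least $k\in\mathbb{N}$ with $T_0^k(f)=1$. (These stopping times are finite.) *)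

theory Defs
  imports "HOL-Analysis.Analysis" "HOL-Computational_Algebra.Polynomial" "HOL-Library.Z2"
begin

definition T :: "bit poly \<Rightarrow> bit poly" where
  "T f = (if poly f 1 = 0 then f div [:1, 1:] else ([:0, 1:] * f + 1) div [:1, 1:])"

definition T0 :: "bit poly \<Rightarrow> bit poly" where
  "T0 f = (if poly f 0 = 0 then f div [:0, 1:] else [:1, 1:] * f + 1)"

definition tau :: "bit poly \<Rightarrow> nat" where
  "tau f = (LEAST k. (T ^^ k) f = 1)"

definition tau0 :: "bit poly \<Rightarrow> nat" where
  "tau0 f = (LEAST k. (T0 ^^ k) f = 1)"

definition rho :: "nat \<Rightarrow> real" where
  "rho n = (\<Sum>f\<in>{f :: bit poly. f \<noteq> 0 \<and> degree f = n}. real (tau f)) / 2 ^ n"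

definition rho0 :: "nat \<Rightarrow> real" where
  "rho0 n = (\<Sum>f\<in>{f :: bit poly. f \<noteq> 0 \<and> degree f = n}. real (tau0 f)) / 2 ^ n"

end

theory Submission
  imports Defs "HOL-Real_Asymp.Real_Asymp"
begin

text \<open>
  Substituting \<open>x + 1\<close> for \<open>x\<close> turns \<open>T\<close> into the accelerated form of \<open>T0\<close>, here called
  \<open>reduced_collatz\<close>: an even step divides by \<open>X\<close> and lowers the degree by one, an odd step
  multiplies by \<open>(X + 1) / X\<close> up to truncation and keeps the degree. A run of degree \<open>n\<close> thus has
  exactly \<open>n\<close> even steps, \<open>\<tau>\<^sub>0 = 2 \<tau> - n\<close>, and it remains to see that there are about \<open>n\<close> odd
  steps on average.

  The first \<open>d\<close> parities of a random polynomial of degree \<open>d\<close> are independent fair bits, so after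
  \<open>d\<close> steps the degree is \<open>d / 2\<close> up to \<open>\<delta> d\<close>, except with probability exponentially small in \<open>d\<close>.
  The iterates are no longer independent of the past, but the polynomial reached after \<open>s\<close> odd and
  \<open>e\<close> even steps is a fixed linear function of the start that preserves uniformity. A union bound
  over the polynomially many pairs \<open>(s, e)\<close> shows that with overwhelming probability every iterate
  of degree at least \<open>n powr (1/3)\<close> halves its degree as expected; summing the geometric series gives
  \<open>\<tau> = 2 n + o(n)\<close>. The remaining polynomials are harmless since always \<open>\<tau> \<le> n (n + 1)\<close>.
\<close>

section \<open>The reduced map and its effect on the degree\<close>

text \<open>\<open>poly_shift 1\<close> drops the constant coefficient and divides by X. On odd
  \<open>f\<close> this yields \<open>((X + 1) * f + 1) / X\<close>, because the product has
  constant coefficient 1.\<close>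

definition reduced_collatz :: "bit poly \<Rightarrow> bit poly" where
  "reduced_collatz f = poly_shift 1 (if coeff f 0 = 0 then f else [:1, 1:] * f)"

primrec odd_steps :: "nat \<Rightarrow> bit poly \<Rightarrow> nat" where
  "odd_steps 0 f = 0"
| "odd_steps (Suc k) f = odd_steps k f + (if coeff ((reduced_collatz ^^ k) f) 0 = 0 then 0 else 1)"

text \<open>Kept generic so that the same facts serve both \<open>reduced_collatz\<close> and
  \<open>T0\<close>.\<close>

definition stopping_time :: "('a \<Rightarrow> 'a) \<Rightarrow> 'a \<Rightarrow> 'a \<Rightarrow> nat" where
  "stopping_time F a x = (LEAST k. (F ^^ k) x = a)"

abbreviation reduced_tau :: "bit poly \<Rightarrow> nat" where
  "reduced_tau \<equiv> stopping_time reduced_collatz 1"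

definition polys_of_degree :: "nat \<Rightarrow> bit poly set" where
  "polys_of_degree n = {f. f \<noteq> 0 \<and> degree f = n}"

lemma bit_poly_add_self: "f + f = (0 :: bit poly)"
  by (simp only: poly_eq_iff coeff_add) simp

lemma bit_poly_add_self_left: "f + (f + g) = (g :: bit poly)"
  by (simp only: add.assoc [symmetric] bit_poly_add_self add_0_left)

lemma poly_shift_1_pCons [simp]: "poly_shift (Suc 0) (pCons a p) = p"
  by (simp add: poly_eq_iff coeff_poly_shift)

lemma poly_shift_add: "poly_shift k (f + g) = poly_shift k f + poly_shift k g"
  for f g :: "'a::comm_monoid_add poly"
  by (simp add: poly_eq_iff coeff_poly_shift)

lemma reduced_collatz_even: "reduced_collatz (pCons 0 p) = p"
  by (simp add: reduced_collatz_def)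

lemma reduced_collatz_odd: "reduced_collatz (pCons 1 p) = 1 + [:1, 1:] * p"
proof -
  have "[:1, 1:] * pCons 1 p = pCons 1 (1 + [:1, 1:] * p)"
    by (simp add: one_pCons)
  then show ?thesis
    by (simp add: reduced_collatz_def del: mult_pCons_left mult_pCons_right)
qed

lemma bit_poly_cases [case_names even odd]:
  obtains p where "f = pCons (0::bit) p" | p where "f = pCons 1 p"
proof -
  obtain a p where "f = pCons a p" by (cases f)
  then show thesis using that by (cases a) auto
qed

lemma reduced_collatz_nonzero: "f \<noteq> 0 \<Longrightarrow> reduced_collatz f \<noteq> 0"
proof (cases f rule: bit_poly_cases)
  case (odd p)
  then have "poly (reduced_collatz f) 1 = 1"
    by (simp add: reduced_collatz_odd)
  then show ?thesis by auto
qed (auto simp: reduced_collatz_even)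

lemma degree_reduced_collatz:
  assumes "f \<noteq> 0"
  shows "degree (reduced_collatz f) + 1 = degree f + (if coeff f 0 = 0 then 0 else 1)"
proof (cases f rule: bit_poly_cases)
  case (even p)
  then show ?thesis using assms by (simp add: reduced_collatz_even)
next
  case (odd p)
  show ?thesis
  proof (cases "p = 0")
    \<comment> \<open>Here \<open>f = 1\<close>, which is a fixed point of the map.\<close>
    case True
    then show ?thesis using odd by (simp add: reduced_collatz_odd)
  next
    case False
    have "degree ([:1, 1:] * p) = Suc (degree p)"
      using False by (subst degree_mult_eq) auto
    then have "degree (1 + [:1, 1:] * p) = Suc (degree p)"
      by (subst degree_add_eq_right) (simp_all only: degree_1 zero_less_Suc)
    then show ?thesis using odd False by (simp add: reduced_collatz_odd)
  qed
qed

lemma reduced_collatz_add_X_mult: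
  "reduced_collatz (f + [:0, 1:] * w) =
     reduced_collatz f + [:1, 1:] ^ (if coeff f 0 = 0 then 0 else 1) * w"
proof (cases f rule: bit_poly_cases)
  case (even p)
  then have "f + [:0, 1:] * w = pCons 0 (p + w)" by simp
  then show ?thesis using even by (simp only: reduced_collatz_even) simp
next
  case (odd p)
  then have "f + [:0, 1:] * w = pCons 1 (p + w)" "coeff f 0 = 1" by simp_all
  then show ?thesis using odd
    by (simp only: reduced_collatz_odd distrib_left add.assoc power_one_right one_neq_zero if_False)
qed

section \<open>Iterates in closed form\<close>

lemma funpow_reduced_collatz_nonzero:
  "f \<noteq> 0 \<Longrightarrow> (reduced_collatz ^^ k) f \<noteq> 0"
  by (induction k) (simp_all add: reduced_collatz_nonzero)

lemma degree_funpow_reduced_collatz: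
  assumes "f \<noteq> 0"
  shows "degree ((reduced_collatz ^^ k) f) + k = degree f + odd_steps k f"
proof (induction k)
  case (Suc k)
  from degree_reduced_collatz [OF funpow_reduced_collatz_nonzero [OF assms, of k]] Suc
  show ?case by simp
qed simp

lemma odd_steps_le: "odd_steps k f \<le> k"
  by (induction k) auto

text \<open>Every step divides the perturbation by X, and an odd step also multiplies it by
  \<open>X + 1\<close>. Until its k factors X are used up it has constant coefficient 0, so the
  parities do not see it.\<close>

lemma funpow_reduced_collatz_add_X_power_mult:
  "(reduced_collatz ^^ k) (f + [:0, 1:] ^ k * u) = (reduced_collatz ^^ k) f + [:1, 1:] ^ odd_steps k f * u
   \<and> odd_steps k (f + [:0, 1:] ^ k * u) = odd_steps k f"
proof (induction k arbitrary: u)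
  case (Suc k)
  let ?g = "(reduced_collatz ^^ k) f" and ?P = "[:1, 1:] ^ odd_steps k f :: bit poly"
  have arg: "f + [:0, 1:] ^ Suc k * u = f + [:0, 1:] ^ k * ([:0, 1:] * u)"
    by (simp only: power_Suc2 mult.assoc)
  have swap: "?g + ?P * ([:0, 1:] * u) = ?g + [:0, 1:] * (?P * u)"
    by (simp only: mult.left_commute)
  have par: "coeff (?g + [:0, 1:] * (?P * u)) 0 = coeff ?g 0"
    by simp
  have it: "(reduced_collatz ^^ k) (f + [:0, 1:] ^ Suc k * u) = ?g + [:0, 1:] * (?P * u)"
    unfolding arg swap [symmetric] using Suc.IH by blast
  have od: "odd_steps k (f + [:0, 1:] ^ Suc k * u) = odd_steps k f"
    unfolding arg using Suc.IH by blast
  have "(reduced_collatz ^^ Suc k) (f + [:0, 1:] ^ Suc k * u) = reduced_collatz (?g + [:0, 1:] * (?P * u))"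
    by (simp only: funpow.simps o_apply it)
  also have "\<dots> = reduced_collatz ?g + [:1, 1:] ^ (if coeff ?g 0 = 0 then 0 else 1) * (?P * u)"
    by (rule reduced_collatz_add_X_mult)
  also have "\<dots> = (reduced_collatz ^^ Suc k) f + [:1, 1:] ^ odd_steps (Suc k) f * u"
    by (simp only: funpow.simps o_apply odd_steps.simps power_add mult.assoc mult.left_commute)
  finally show ?case
    by (simp only: odd_steps.simps it od par simp_thms)
qed simp

text \<open>Truncating before the multiplication spoils only the constant coefficient, the one place
  where a carry from below the cut would arrive; the outer shift discards it.\<close>

lemma poly_shift_linear_mult_poly_shift:
  "poly_shift 1 ([:1, 1:] * poly_shift k g) = poly_shift (Suc k) ([:1, 1:] * g)"
  for g :: "'a::comm_semiring_1 poly"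
  by (simp add: poly_eq_iff coeff_poly_shift)

lemma poly_shift_poly_shift: "poly_shift i (poly_shift k g) = poly_shift (i + k) g"
  by (simp add: poly_eq_iff coeff_poly_shift add.assoc)

text \<open>All truncations can be postponed to the end. Once the number of odd steps is fixed, the
  iterate is linear in \<open>f\<close>.\<close>

lemma funpow_reduced_collatz_eq_poly_shift:
  "(reduced_collatz ^^ k) f = poly_shift k ([:1, 1:] ^ odd_steps k f * f)"
proof (induction k)
  case (Suc k)
  let ?g = "(reduced_collatz ^^ k) f"
  show ?case
  proof (cases "coeff ?g 0 = 0")
    case True
    then have "(reduced_collatz ^^ Suc k) f = poly_shift 1 ?g"
      by (simp add: reduced_collatz_def)
    also have "\<dots> = poly_shift (Suc k) ([:1, 1:] ^ odd_steps k f * f)"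
      by (subst Suc.IH) (simp only: poly_shift_poly_shift plus_1_eq_Suc)
    finally show ?thesis using True by simp
  next
    case False
    then have "(reduced_collatz ^^ Suc k) f = poly_shift 1 ([:1, 1:] * ?g)"
      by (simp only: funpow.simps o_apply reduced_collatz_def if_False)
    also have "\<dots> = poly_shift (Suc k) ([:1, 1:] * ([:1, 1:] ^ odd_steps k f * f))"
      by (subst Suc.IH) (rule poly_shift_linear_mult_poly_shift)
    also have "[:1, 1:] * ([:1, 1:] ^ odd_steps k f * f) = [:1, 1:] ^ odd_steps (Suc k) f * f"
      using False by (simp only: odd_steps.simps if_False add_Suc_right add_0_right One_nat_def power_Suc mult.assoc)
    finally show ?thesis .
  qed
qed simp

section \<open>Stopping times and termination in quadratic time\<close>

lemma stopping_time_le: "(F ^^ k) x = a \<Longrightarrow> stopping_time F a x \<le> k"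
  unfolding stopping_time_def by (rule Least_le)

lemma funpow_stopping_time: "\<exists>k. (F ^^ k) x = a \<Longrightarrow> (F ^^ stopping_time F a x) x = a"
  unfolding stopping_time_def by (rule LeastI_ex)

lemma stopping_time_self [simp]: "stopping_time F a a = 0"
  using stopping_time_le [of 0 F a a] by simp

lemma stopping_time_funpow:
  assumes "\<exists>k. (F ^^ k) x = a" and "j \<le> stopping_time F a x"
  shows "stopping_time F a x = j + stopping_time F a ((F ^^ j) x)"
proof (rule antisym)
  let ?t = "stopping_time F a x"
  have "(F ^^ (?t - j)) ((F ^^ j) x) = (F ^^ ?t) x"
    using assms(2) by (metis funpow_add o_apply le_add_diff_inverse2)
  then have hit: "(F ^^ (?t - j)) ((F ^^ j) x) = a"
    using funpow_stopping_time [OF assms(1)] by simp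
  then show "j + stopping_time F a ((F ^^ j) x) \<le> ?t"
    using stopping_time_le [OF hit] assms(2) by simp
  have "(F ^^ stopping_time F a ((F ^^ j) x)) ((F ^^ j) x) = a"
    by (rule funpow_stopping_time) (use hit in blast)
  then have "(F ^^ (j + stopping_time F a ((F ^^ j) x))) x = a"
    by (metis funpow_add o_apply add.commute)
  then show "?t \<le> j + stopping_time F a ((F ^^ j) x)"
    by (rule stopping_time_le)
qed

lemma stopping_time_Suc:
  assumes "\<exists>k. (F ^^ k) (F x) = a" and "x \<noteq> a"
  shows "stopping_time F a x = Suc (stopping_time F a (F x))"
proof -
  from assms(1) obtain k where "(F ^^ k) (F x) = a" by blast
  then have ex: "(F ^^ Suc k) x = a" by (simp only: funpow_Suc_right o_apply)
  have "stopping_time F a x \<noteq> 0"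
    using funpow_stopping_time [of F x a] ex assms(2) by (metis funpow_0)
  then show ?thesis
    using stopping_time_funpow [of F x a 1] ex by fastforce
qed

text \<open>On an odd \<open>f\<close> the map acts on \<open>f + 1\<close> as multiplication by \<open>(X + 1) / X\<close>, so a run of
  odd steps has the length of the order of vanishing of \<open>f + 1\<close> at \<open>0\<close>.\<close>

lemma funpow_reduced_collatz_even_after_run:
  assumes "coeff u 0 = 1"
  shows "coeff ((reduced_collatz ^^ m) (1 + [:0, 1:] ^ m * u)) 0 = 0"
  using assms
proof (induction m arbitrary: u)
  case (Suc m)
  have "1 + [:0, 1:] ^ Suc m * u = pCons 1 ([:0, 1:] ^ m * u)"
    by (simp add: one_pCons)
  then have "reduced_collatz (1 + [:0, 1:] ^ Suc m * u) = 1 + [:0, 1:] ^ m * ([:1, 1:] * u)"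
    by (simp only: reduced_collatz_odd mult.left_commute)
  moreover have "coeff ([:1, 1:] * u) 0 = 1"
    using Suc.prems by simp
  ultimately show ?case
    using Suc.IH [of "[:1, 1:] * u"] by (simp only: funpow_Suc_right o_apply)
qed simp

text \<open>The order of vanishing of \<open>f + 1\<close> at 0 is at most its degree. Positive
  degree rules out the fixed point 1, whose odd run never ends.\<close>

lemma ex_even_iterate:
  assumes "degree f > 0"
  shows "\<exists>m\<le>degree f. coeff ((reduced_collatz ^^ m) f) 0 = 0"
proof -
  let ?m = "order 0 (f + 1)"
  have nz: "f + 1 \<noteq> 0"
  proof
    assume "f + 1 = 0"
    then have "f = - 1" by (simp only: eq_neg_iff_add_eq_0)
    then show False using assms by simp
  qed
  then obtain u where u: "f + 1 = [:0, 1:] ^ ?m * u" "\<not> [:0, 1:] dvd u"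
    using order_decomp [of "f + 1" 0] by auto
  have "coeff u 0 = 1"
    using u(2) poly_eq_0_iff_dvd [of u 0] by (auto simp: poly_0_coeff_0)
  moreover have "f = 1 + [:0, 1:] ^ ?m * u"
    using bit_poly_add_self_left [of 1 f] u(1) by (metis add.commute)
  ultimately have "coeff ((reduced_collatz ^^ ?m) f) 0 = 0"
    using funpow_reduced_collatz_even_after_run [of u ?m] by metis
  moreover have "?m \<le> degree (f + 1)"
    using nz by (rule order_degree)
  moreover have "degree (f + 1) \<le> degree f"
    by (rule degree_add_le) auto
  ultimately show ?thesis by (meson le_trans)
qed

text \<open>An even iterate occurs within \<open>degree f\<close> steps, and the step after it makes
  the degree smaller than at the start; so each drop costs at most \<open>degree f + 1\<close>
  steps.\<close>

lemma reduced_collatz_reaches_1: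
  assumes "f \<noteq> 0"
  shows "\<exists>k \<le> degree f * (degree f + 1). (reduced_collatz ^^ k) f = 1"
  using assms
proof (induction "degree f" arbitrary: f rule: less_induct)
  case less
  show ?case
  proof (cases "degree f = 0")
    case True
    then obtain a where "f = [:a:]" by (rule degree_eq_zeroE)
    with less.prems have "f = 1" by (cases a) (auto simp: one_pCons)
    then show ?thesis by auto
  next
    case False
    then obtain m where m: "m \<le> degree f" "coeff ((reduced_collatz ^^ m) f) 0 = 0"
      using ex_even_iterate by blast
    define g where "g = (reduced_collatz ^^ Suc m) f"
    have "odd_steps (Suc m) f \<le> m"
      using m(2) odd_steps_le [of m f] by simp
    then have deg: "degree g < degree f"
      using degree_funpow_reduced_collatz [OF less.prems, of "Suc m"] unfolding g_def by linarith
    have "g \<noteq> 0"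
      unfolding g_def using less.prems by (rule funpow_reduced_collatz_nonzero)
    from less.hyps [OF deg this] obtain k
      where k: "k \<le> degree g * (degree g + 1)" "(reduced_collatz ^^ k) g = 1" by blast
    have "(reduced_collatz ^^ (k + Suc m)) f = 1"
      using k(2) by (simp only: g_def funpow_add o_apply)
    moreover have "k + Suc m \<le> degree f * (degree f + 1)"
    proof -
      have "degree g * (degree g + 1) \<le> (degree f - 1) * degree f"
        using deg by (intro mult_mono) auto
      moreover have "(degree f - 1) * degree f + (degree f + 1) \<le> degree f * (degree f + 1)"
        using False by (cases "degree f") auto
      ultimately show ?thesis using k(1) m(1) by linarith
    qed
    ultimately show ?thesis by blast
  qed
qed

lemma reduced_tau_le: "f \<noteq> 0 \<Longrightarrow> reduced_tau f \<le> degree f * (degree f + 1)"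
  using reduced_collatz_reaches_1 stopping_time_le le_trans by metis

text \<open>A step lowers the degree by at most one, and the run ends in degree 0.\<close>

lemma degree_le_reduced_tau:
  assumes "f \<noteq> 0"
  shows "degree f \<le> reduced_tau f"
proof -
  have "(reduced_collatz ^^ reduced_tau f) f = 1"
    by (rule funpow_stopping_time) (use reduced_collatz_reaches_1 [OF assms] in blast)
  then show ?thesis
    using degree_funpow_reduced_collatz [OF assms, of "reduced_tau f"] by simp
qed

lemma reduced_tau_funpow:
  assumes "f \<noteq> 0" and "j \<le> reduced_tau f"
  shows "reduced_tau f = j + reduced_tau ((reduced_collatz ^^ j) f)"
  using reduced_collatz_reaches_1 [OF assms(1)] assms(2) by (intro stopping_time_funpow) auto

section \<open>Counting polynomials and the distribution of parities\<close>

text \<open>Constraining coefficients rather than the degree includes the zero polynomial and makes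
  \<open>low_polys 0\<close> equal to \<open>{0}\<close>.\<close>

definition low_polys :: "nat \<Rightarrow> bit poly set" where
  "low_polys k = {f. \<forall>i\<ge>k. coeff f i = 0}"

lemma card_pCons_image:
  "card ((\<lambda>(a :: bit, p). pCons a p) ` (UNIV \<times> A)) = 2 * card A"
proof -
  have UNIV_bit: "(UNIV :: bit set) = {0, 1}"
    using bit_not_one_iff by auto
  have "card (UNIV :: bit set) = 2"
    unfolding UNIV_bit by simp
  then show ?thesis
    by (subst card_image) (auto simp: inj_on_def card_cartesian_product)
qed

lemma card_low_polys: "card (low_polys k) = 2 ^ k"
proof (induction k)
  case 0
  have "low_polys 0 = {0}" by (auto simp: low_polys_def poly_eq_iff)
  then show ?case by simp
next
  case (Suc k)
  have "low_polys (Suc k) = (\<lambda>(a, p). pCons a p) ` (UNIV \<times> low_polys k)" (is "?L = ?R")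
  proof
    show "?R \<subseteq> ?L"
      by (auto simp: low_polys_def coeff_pCons split: nat.splits)
    show "?L \<subseteq> ?R"
    proof
      fix f assume f: "f \<in> ?L"
      obtain a p where ap: "f = pCons a p" by (cases f)
      have "coeff p i = 0" if "k \<le> i" for i
        using f ap that by (auto simp: low_polys_def dest!: spec [of _ "Suc i"])
      then show "f \<in> ?R" using ap by (auto simp: low_polys_def)
    qed
  qed
  then show ?case by (simp add: card_pCons_image Suc.IH)
qed

lemma finite_low_polys: "finite (low_polys k)"
  by (rule card_ge_0_finite) (simp add: card_low_polys)

lemma card_polys_of_degree: "card (polys_of_degree n) = 2 ^ n"
proof (induction n)
  case 0
  have "polys_of_degree 0 = {1}"
  proof -
    have "f = 1" if "f \<noteq> 0" "degree f = 0" for f :: "bit poly"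
    proof -
      from that(2) obtain a where "f = [:a:]" by (rule degree_eq_zeroE)
      with that(1) show ?thesis by (cases a) (auto simp: one_pCons)
    qed
    then show ?thesis by (auto simp: polys_of_degree_def)
  qed
  then show ?case by simp
next
  case (Suc n)
  have "polys_of_degree (Suc n) = (\<lambda>(a, p). pCons a p) ` (UNIV \<times> polys_of_degree n)" (is "?L = ?R")
  proof
    show "?R \<subseteq> ?L"
      by (auto simp: polys_of_degree_def)
    show "?L \<subseteq> ?R"
    proof
      fix f assume f: "f \<in> ?L"
      obtain a p where ap: "f = pCons a p" by (cases f)
      then show "f \<in> ?R" using f by (auto simp: polys_of_degree_def split: if_splits)
    qed
  qed
  then show ?case by (simp add: card_pCons_image Suc.IH)
qed

lemma finite_polys_of_degree: "finite (polys_of_degree n)"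
  by (rule card_ge_0_finite) (simp add: card_polys_of_degree)

text \<open>Adding \<open>X ^ k\<close> leaves the first \<open>k\<close> parities unchanged and flips the next one; hence the first
  \<open>n\<close> parities of a random polynomial of degree \<open>n\<close> are independent fair bits.\<close>

lemma sum_power_odd_steps:
  fixes t :: real
  assumes "k \<le> n"
  shows "(\<Sum>f\<in>polys_of_degree n. t ^ odd_steps k f) = 2 ^ n * ((1 + t) / 2) ^ k"
  using assms
proof (induction k)
  case 0
  then show ?case by (simp add: card_polys_of_degree)
next
  case (Suc k)
  define flip :: "bit poly \<Rightarrow> bit poly" where "flip f = f + [:0, 1:] ^ k" for f
  have flip_flip: "flip (flip f) = f" for f
    using bit_poly_add_self_left [of "[:0, 1:] ^ k" f] by (simp only: flip_def ac_simps)
  have flip_mem: "flip f \<in> polys_of_degree n" if "f \<in> polys_of_degree n" for f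
  proof -
    have "degree ([:0, 1:] ^ k :: bit poly) = k"
      by (simp add: degree_power_eq)
    \<comment> \<open>As \<open>k < n\<close>, the flip does not touch the leading
      coefficient.\<close>
    then have "degree (flip f) = n"
      using that Suc.prems by (simp add: flip_def polys_of_degree_def degree_add_eq_left)
    then show ?thesis using Suc.prems by (auto simp: polys_of_degree_def)
  qed
  have bij: "bij_betw flip (polys_of_degree n) (polys_of_degree n)"
    by (rule bij_betw_byWitness [where f' = flip]) (auto simp: flip_flip flip_mem)
  have pair: "t ^ odd_steps (Suc k) f + t ^ odd_steps (Suc k) (flip f) = (1 + t) * t ^ odd_steps k f" for f
  proof -
    have it: "(reduced_collatz ^^ k) (flip f) = (reduced_collatz ^^ k) f + [:1, 1:] ^ odd_steps k f"
      and od: "odd_steps k (flip f) = odd_steps k f"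
      using funpow_reduced_collatz_add_X_power_mult [of k f 1] by (simp_all add: flip_def)
    have "coeff ([:1, 1:] ^ odd_steps k f :: bit poly) 0 = 1"
      by (simp only: poly_0_coeff_0 [symmetric] poly_power) simp
    then have "coeff ((reduced_collatz ^^ k) (flip f)) 0 = 0 \<longleftrightarrow> coeff ((reduced_collatz ^^ k) f) 0 \<noteq> 0"
      unfolding it coeff_add by (cases "coeff ((reduced_collatz ^^ k) f) 0") auto
    then show ?thesis
      by (simp add: od algebra_simps)
  qed
  \<comment> \<open>Summing over \<open>f\<close> and over \<open>flip f\<close> counts everything
    twice, which avoids choosing a representative of each pair.\<close>
  have "2 * (\<Sum>f\<in>polys_of_degree n. t ^ odd_steps (Suc k) f)
      = (\<Sum>f\<in>polys_of_degree n. t ^ odd_steps (Suc k) f) + (\<Sum>f\<in>polys_of_degree n. t ^ odd_steps (Suc k) (flip f))"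
    using sum.reindex_bij_betw [OF bij, of "\<lambda>f. t ^ odd_steps (Suc k) f"] by simp
  also have "\<dots> = (1 + t) * (\<Sum>f\<in>polys_of_degree n. t ^ odd_steps k f)"
    by (simp only: sum.distrib [symmetric] pair sum_distrib_left)
  also have "\<dots> = (1 + t) * (2 ^ n * ((1 + t) / 2) ^ k)"
    using Suc by simp
  finally show ?case
    by (simp only: power_Suc) (simp add: field_simps del: odd_steps.simps)
qed

section \<open>Exponential tail bounds for the number of odd steps\<close>

text \<open>Controls the moment generating function of one centred fair bit; the constant is not
  sharp, but only exponential decay matters.\<close>

lemma cosh_le_exp_square:
  fixes x :: real
  assumes "\<bar>x\<bar> \<le> 1"
  shows "cosh x \<le> exp (x\<^sup>2)"
proof -
  \<comment> \<open>The quadratic bounds \<open>1 + y + y^2\<close> for \<open>exp y\<close> and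
    \<open>1 - y + y^2\<close> for \<open>exp (- y)\<close> are added, so the linear terms
    cancel.\<close>
  have nonneg: "exp y + exp (- y) \<le> 2 + 2 * y\<^sup>2" if y: "0 \<le> y" "y \<le> 1" for y :: real
  proof -
    have "exp (- y) \<le> 1 / (1 + y)"
      using y exp_ge_add_one_self [of y] by (simp add: exp_minus field_simps)
    also have "\<dots> \<le> 1 - y + y\<^sup>2"
    proof -
      have "1 \<le> 1 + y ^ 3" using y by simp
      also have "\<dots> = (1 - y + y\<^sup>2) * (1 + y)" by (simp add: power2_eq_square power3_eq_cube algebra_simps)
      finally show ?thesis using y by (simp add: field_simps)
    qed
    finally show ?thesis using exp_bound [OF y] by simp
  qed
  have "exp x + exp (- x) \<le> 2 + 2 * x\<^sup>2"
    using nonneg [of "\<bar>x\<bar>"] assms by (cases "x \<ge> 0") auto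
  then have "cosh x \<le> 1 + x\<^sup>2"
    by (simp add: cosh_def)
  also have "\<dots> \<le> exp (x\<^sup>2)"
    by (rule exp_ge_add_one_self)
  finally show ?thesis .
qed

text \<open>Chernoff's method with parameter \<open>2 * c\<close>. The sign of \<open>c\<close>
  selects the upper or the lower tail.\<close>

lemma card_odd_steps_tail:
  fixes c :: real
  assumes "\<bar>c\<bar> \<le> 1"
  shows "real (card {f \<in> polys_of_degree d. c * (real (odd_steps d f) - d / 2) > c\<^sup>2 * d})
    \<le> 2 ^ d * exp (- c\<^sup>2) ^ d"
proof -
  let ?A = "{f \<in> polys_of_degree d. c * (real (odd_steps d f) - d / 2) > c\<^sup>2 * d}"
  let ?w = "\<lambda>f. exp (2 * c * (real (odd_steps d f) - d / 2) - 2 * c\<^sup>2 * d)"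
  have "real (card ?A) = (\<Sum>f\<in>?A. 1)" by simp
  \<comment> \<open>On \<open>?A\<close> the exponent is positive, so every weight is at least
    1.\<close>
  also have "\<dots> \<le> (\<Sum>f\<in>?A. ?w f)"
    by (rule sum_mono) auto
  also have "\<dots> \<le> (\<Sum>f\<in>polys_of_degree d. ?w f)"
    by (rule sum_mono2) (auto simp: finite_polys_of_degree)
  also have "\<dots> = (\<Sum>f\<in>polys_of_degree d. exp (- c - 2 * c\<^sup>2) ^ d * exp (2 * c) ^ odd_steps d f)"
    by (rule sum.cong) (simp_all add: exp_of_nat_mult [symmetric] exp_add [symmetric] algebra_simps)
  also have "\<dots> = exp (- c - 2 * c\<^sup>2) ^ d * (2 ^ d * ((1 + exp (2 * c)) / 2) ^ d)"
    by (simp add: sum_distrib_left [symmetric] sum_power_odd_steps)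
  also have "\<dots> = 2 ^ d * (exp (- c - 2 * c\<^sup>2) * ((1 + exp (2 * c)) / 2)) ^ d"
    by (simp only: power_mult_distrib ac_simps)
  also have "exp (- c - 2 * c\<^sup>2) * ((1 + exp (2 * c)) / 2) = cosh c * exp (- 2 * c\<^sup>2)"
    by (simp add: cosh_def field_simps exp_add [symmetric] exp_diff exp_minus flip: exp_double)
  also have "2 ^ d * (cosh c * exp (- 2 * c\<^sup>2)) ^ d \<le> 2 ^ d * (exp (c\<^sup>2) * exp (- 2 * c\<^sup>2)) ^ d"
    using cosh_le_exp_square [OF assms] by (intro mult_left_mono power_mono mult_right_mono) auto
  also have "exp (c\<^sup>2) * exp (- 2 * c\<^sup>2) = exp (- c\<^sup>2)"
    by (simp add: exp_add [symmetric])
  finally show ?thesis .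
qed

definition deviating :: "real \<Rightarrow> nat \<Rightarrow> bit poly set" where
  "deviating \<delta> d = {f \<in> polys_of_degree d. \<bar>real (odd_steps d f) - d / 2\<bar> > \<delta> * d}"

lemma card_deviating:
  assumes "0 < \<delta>" "\<delta> \<le> 1"
  shows "real (card (deviating \<delta> d)) \<le> 2 * 2 ^ d * exp (- \<delta>\<^sup>2) ^ d"
proof -
  let ?A = "\<lambda>c :: real. {f \<in> polys_of_degree d. c * (real (odd_steps d f) - d / 2) > c\<^sup>2 * d}"
  have sub: "deviating \<delta> d \<subseteq> ?A \<delta> \<union> ?A (- \<delta>)"
  proof
    fix f assume f: "f \<in> deviating \<delta> d"
    define x where "x = real (odd_steps d f) - d / 2"
    from f have "x > \<delta> * d \<or> - x > \<delta> * d"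
      unfolding deviating_def x_def by auto
    then have "\<delta> * x > \<delta> * (\<delta> * d) \<or> \<delta> * (- x) > \<delta> * (\<delta> * d)"
      using assms(1) by (simp only: mult_less_cancel_left_pos)
    then show "f \<in> ?A \<delta> \<union> ?A (- \<delta>)"
      using f by (auto simp: deviating_def x_def power2_eq_square mult.assoc algebra_simps)
  qed
  have fin: "finite (?A c)" for c
    using finite_polys_of_degree by simp
  have "real (card (deviating \<delta> d)) \<le> real (card (?A \<delta> \<union> ?A (- \<delta>)))"
    by (intro of_nat_mono card_mono [OF _ sub] finite_UnI fin)
  also have "\<dots> \<le> real (card (?A \<delta>)) + real (card (?A (- \<delta>)))"
    using card_Un_le [of "?A \<delta>" "?A (- \<delta>)"] by linarith
  also have "\<dots> \<le> 2 ^ d * exp (- \<delta>\<^sup>2) ^ d + 2 ^ d * exp (- (- \<delta>)\<^sup>2) ^ d"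
    using assms by (intro add_mono card_odd_steps_tail) auto
  finally show ?thesis by simp
qed

lemma finite_deviating: "finite (deviating \<delta> d)"
  by (simp add: deviating_def finite_polys_of_degree)

section \<open>The union bound over all iterates\<close>

text \<open>The map is additive, so a fibre lies in a translate of its kernel. Multiplication by
  \<open>(X + 1) ^ s\<close> raises the degree by exactly \<open>s\<close>, so kernel elements have
  no coefficient from position \<open>e\<close> on.\<close>

lemma card_fiber_le:
  fixes g :: "bit poly"
  shows "card {f \<in> A. poly_shift (s + e) ([:1, 1:] ^ s * f) = g} \<le> 2 ^ e"
proof (cases "{f \<in> A. poly_shift (s + e) ([:1, 1:] ^ s * f) = g} = {}")
  case False
  then obtain f0 where f0: "poly_shift (s + e) ([:1, 1:] ^ s * f0) = g" by blast
  have "{f \<in> A. poly_shift (s + e) ([:1, 1:] ^ s * f) = g} \<subseteq> (\<lambda>r. f0 + r) ` low_polys e"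
  proof
    fix f assume "f \<in> {f \<in> A. poly_shift (s + e) ([:1, 1:] ^ s * f) = g}"
    then have f: "poly_shift (s + e) ([:1, 1:] ^ s * f) = g" by simp
    define r where "r = f - f0"
    define q where "q = [:1, 1:] ^ s * r"
    have q0: "coeff q i = 0" if "s + e \<le> i" for i
    proof -
      have "coeff ([:1, 1:] ^ s * f) (i - (s + e) + (s + e)) = coeff ([:1, 1:] ^ s * f0) (i - (s + e) + (s + e))"
        by (simp only: coeff_poly_shift [symmetric] f f0)
      then have "coeff ([:1, 1:] ^ s * f) i = coeff ([:1, 1:] ^ s * f0) i"
        using that by simp
      then show ?thesis
        by (simp only: q_def r_def right_diff_distrib coeff_diff diff_self)
    qed
    have "coeff r i = 0" if i: "e \<le> i" for i
    proof (rule ccontr)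
      assume nz: "coeff r i \<noteq> 0"
      then have "r \<noteq> 0" and "i \<le> degree r" by (auto intro: le_degree)
      then have "q \<noteq> 0" and "degree q = s + degree r"
        by (simp_all add: q_def degree_mult_eq degree_power_eq)
      then show False
        using q0 [of "degree q"] i \<open>i \<le> degree r\<close> leading_coeff_0_iff [of q] by simp
    qed
    then show "f \<in> (\<lambda>r. f0 + r) ` low_polys e"
      by (intro image_eqI [of _ _ r]) (auto simp: low_polys_def r_def)
  qed
  then have "card {f \<in> A. poly_shift (s + e) ([:1, 1:] ^ s * f) = g} \<le> card (low_polys e)"
    by (rule surj_card_le [OF finite_low_polys])
  then show ?thesis by (simp add: card_low_polys)
qed (simp only: card.empty zero_le)

lemma card_preimage_le:
  fixes E :: "bit poly set"
  assumes "finite E"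
  shows "card {f \<in> A. poly_shift (s + e) ([:1, 1:] ^ s * f) \<in> E} \<le> 2 ^ e * card E"
proof -
  have "{f \<in> A. poly_shift (s + e) ([:1, 1:] ^ s * f) \<in> E}
      = (\<Union>g\<in>E. {f \<in> A. poly_shift (s + e) ([:1, 1:] ^ s * f) = g})" by blast
  then have "card {f \<in> A. poly_shift (s + e) ([:1, 1:] ^ s * f) \<in> E}
      \<le> (\<Sum>g\<in>E. card {f \<in> A. poly_shift (s + e) ([:1, 1:] ^ s * f) = g})"
    using card_UN_le [OF assms] by simp
  also have "\<dots> \<le> (\<Sum>g\<in>E. 2 ^ e)"
    by (intro sum_mono card_fiber_le)
  finally show ?thesis by (simp add: mult.commute)
qed

text \<open>If \<open>f\<close> reaches \<open>g\<close> after \<open>s\<close> odd and \<open>e\<close> even steps then \<open>g = poly_shift (s + e) ((1 + X) ^ s * f)\<close>.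
  For fixed \<open>s\<close> and \<open>e\<close> this map sends the uniform distribution on degree \<open>n\<close> to the uniform
  distribution on degree \<open>n - e\<close>, so a union bound over \<open>s\<close> and \<open>e\<close> controls all iterates at once.\<close>

definition exceptional :: "real \<Rightarrow> nat \<Rightarrow> nat \<Rightarrow> bit poly set" where
  "exceptional \<delta> K n = (\<Union>(s, e)\<in>{..n * (n + 1)} \<times> {e. e \<le> n \<and> K \<le> n - e}.
     {f \<in> polys_of_degree n. poly_shift (s + e) ([:1, 1:] ^ s * f) \<in> deviating \<delta> (n - e)})"

lemma card_exceptional:
  assumes "0 < \<delta>" "\<delta> \<le> 1"
  shows "real (card (exceptional \<delta> K n))
    \<le> 2 ^ n * (2 * (real n * (real n + 1) + 1) * (real n + 1) * exp (- \<delta>\<^sup>2) ^ K)"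
proof -
  let ?I = "{..n * (n + 1)} \<times> {e. e \<le> n \<and> K \<le> n - e}"
  let ?F = "\<lambda>s e. {f \<in> polys_of_degree n. poly_shift (s + e) ([:1, 1:] ^ s * f) \<in> deviating \<delta> (n - e)}"
  let ?b = "2 ^ n * (2 * exp (- \<delta>\<^sup>2) ^ K)"
  have finI: "finite ?I" by simp
  have each: "real (card (?F s e)) \<le> ?b" if "(s, e) \<in> ?I" for s e
  proof -
    have e: "e \<le> n" "K \<le> n - e" using that by auto
    have "real (card (?F s e)) \<le> real (2 ^ e * card (deviating \<delta> (n - e)))"
      by (intro of_nat_mono card_preimage_le finite_deviating)
    also have "\<dots> \<le> 2 ^ e * (2 * 2 ^ (n - e) * exp (- \<delta>\<^sup>2) ^ (n - e))"
      using card_deviating [OF assms, of "n - e"] by simp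
    \<comment> \<open>The fibre size \<open>2 ^ e\<close> cancels the loss from passing to degree
      \<open>n - e\<close>. The decay is then weakest at \<open>n - e = K\<close>.\<close>
    also have "\<dots> = 2 ^ n * (2 * exp (- \<delta>\<^sup>2) ^ (n - e))"
      using e(1) by (simp add: power_add [symmetric] mult.assoc mult.left_commute)
    also have "\<dots> \<le> ?b"
      using e(2) by (intro mult_left_mono power_decreasing) auto
    finally show ?thesis .
  qed
  have "real (card (exceptional \<delta> K n)) \<le> (\<Sum>(s, e)\<in>?I. real (card (?F s e)))"
    unfolding exceptional_def using card_UN_le [OF finI, of "\<lambda>(s, e). ?F s e"]
    by (simp only: of_nat_sum [symmetric] of_nat_le_iff case_prod_unfold)
  also have "\<dots> \<le> (\<Sum>(s, e)\<in>?I. ?b)"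
    using each by (intro sum_mono) auto
  also have "\<dots> = real (card ?I) * ?b"
    by (simp only: case_prod_unfold sum_constant)
  also have "\<dots> \<le> real ((n * (n + 1) + 1) * (n + 1)) * ?b"
  proof (intro mult_right_mono of_nat_mono)
    have "card {e. e \<le> n \<and> K \<le> n - e} \<le> card {..n}"
      by (rule card_mono) auto
    then show "card ?I \<le> (n * (n + 1) + 1) * (n + 1)"
      by (simp only: card_cartesian_product card_atMost Suc_eq_plus1) (intro mult_left_mono, auto)
  qed auto
  also have "\<dots> = 2 ^ n * (2 * (real n * (real n + 1) + 1) * (real n + 1) * exp (- \<delta>\<^sup>2) ^ K)"
    by (simp add: algebra_simps)
  finally show ?thesis .
qed

section \<open>Stopping times outside the exceptional set\<close>

lemma abs_reduced_tau_le:
  assumes "f \<noteq> 0"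
  shows "\<bar>real (reduced_tau f) - 2 * real (degree f)\<bar> \<le> (real (degree f))\<^sup>2"
proof -
  have "real (reduced_tau f) \<le> real (degree f * (degree f + 1))"
    using reduced_tau_le [OF assms] by (rule of_nat_mono)
  moreover have "real (degree f) \<le> real (reduced_tau f)"
    using degree_le_reduced_tau [OF assms] by simp
  moreover have "real (degree f) \<le> (real (degree f))\<^sup>2"
    by (simp add: power2_eq_square flip: of_nat_mult)
  ultimately show ?thesis
    by (simp add: power2_eq_square algebra_simps)
qed

text \<open>Induction on the degree of the iterate, with \<open>f\<close> held fixed because
  \<open>exceptional\<close> refers to the start. Running \<open>d\<close> steps from degree
  \<open>d\<close> costs an error of \<open>2 * \<delta> * d\<close> and leaves degree at most
  \<open>3 / 4 * d\<close>. The constant 8 solves \<open>8 * 3 / 4 + 2 = 8\<close>, and the term in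
  \<open>K\<close> absorbs the degrees below \<open>K\<close>.\<close>

lemma reduced_tau_iterate_bound:
  assumes f: "f \<in> polys_of_degree n" "f \<notin> exceptional \<delta> K n" and \<delta>: "0 < \<delta>" "\<delta> \<le> 1 / 4"
    and k: "k \<le> reduced_tau f"
  defines "g \<equiv> (reduced_collatz ^^ k) f"
  shows "\<bar>real (reduced_tau g) - 2 * real (degree g)\<bar> \<le> 8 * \<delta> * degree g + (real K)\<^sup>2"
  using k unfolding g_def
proof (induction "degree ((reduced_collatz ^^ k) f)" arbitrary: k rule: less_induct)
  case less
  define g where "g = (reduced_collatz ^^ k) f"
  define d where "d = degree g"
  define s where "s = odd_steps k f"
  have nz: "f \<noteq> 0" and degf: "degree f = n"
    using f(1) by (auto simp: polys_of_degree_def)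
  have gnz: "g \<noteq> 0"
    unfolding g_def using nz by (rule funpow_reduced_collatz_nonzero)
  have crude: "\<bar>real (reduced_tau g) - 2 * real d\<bar> \<le> (real d)\<^sup>2"
    unfolding d_def using gnz by (rule abs_reduced_tau_le)
  have "\<bar>real (reduced_tau g) - 2 * real d\<bar> \<le> 8 * \<delta> * d + (real K)\<^sup>2"
  \<comment> \<open>Degree 0 is set apart because the degree could not strictly decrease from
    there.\<close>
  proof (cases "d < K \<or> d = 0")
    case True
    then have "(real d)\<^sup>2 \<le> (real K)\<^sup>2"
      by (intro power_mono) auto
    moreover have "0 \<le> 8 * \<delta> * d" using \<delta> by simp
    ultimately show ?thesis using crude by linarith
  next
    case False
    then have d: "K \<le> d" "d > 0" by auto
    have "s \<le> k" unfolding s_def by (rule odd_steps_le)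
    then obtain e where e: "k = s + e" using le_Suc_ex by blast
    have "d + k = n + s"
      using degree_funpow_reduced_collatz [OF nz, of k] by (simp only: d_def g_def s_def degf)
    then have de: "d = n - e" "e \<le> n" using e by auto
    \<comment> \<open>Quadratic termination is what places \<open>s\<close> in the finite range used
      by \<open>exceptional\<close>.\<close>
    have "s \<le> n * (n + 1)"
      using \<open>s \<le> k\<close> less.prems reduced_tau_le [OF nz] degf by simp
    moreover have "g = poly_shift (s + e) ([:1, 1:] ^ s * f)"
      using funpow_reduced_collatz_eq_poly_shift [of k f] e by (metis g_def s_def)
    ultimately have "g \<notin> deviating \<delta> d"
      using f de d unfolding exceptional_def by blast
    then have dev: "\<bar>real (odd_steps d g) - d / 2\<bar> \<le> \<delta> * d"
      using gnz by (auto simp: deviating_def polys_of_degree_def d_def)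
    define h where "h = (reduced_collatz ^^ d) g"
    have h: "h = (reduced_collatz ^^ (d + k)) f"
      by (simp only: h_def g_def funpow_add o_apply)
    have degh: "degree h = odd_steps d g"
      using degree_funpow_reduced_collatz [OF gnz, of d] by (simp add: h_def d_def)
    have "\<delta> * d \<le> 1 / 4 * d" using \<delta> by (intro mult_right_mono) auto
    then have "real (odd_steps d g) < real d" using dev d(2) by linarith
    then have lt: "degree h < d" using degh by simp
    have "d \<le> reduced_tau g"
      unfolding d_def using gnz by (rule degree_le_reduced_tau)
    then have taug: "reduced_tau g = d + reduced_tau h"
      unfolding h_def using gnz by (intro reduced_tau_funpow)
    have "reduced_tau f = k + reduced_tau g"
      unfolding g_def using nz less.prems by (rule reduced_tau_funpow)
    then have "d + k \<le> reduced_tau f" using \<open>d \<le> reduced_tau g\<close> by simp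
    then have IH: "\<bar>real (reduced_tau h) - 2 * real (degree h)\<bar> \<le> 8 * \<delta> * degree h + (real K)\<^sup>2"
      using less.hyps [of "d + k"] lt unfolding h d_def g_def by blast
    have "real (degree h) \<le> (1 / 2 + \<delta>) * d"
      using dev degh by (simp add: algebra_simps abs_le_iff)
    also have "\<dots> \<le> 3 / 4 * d"
      using \<delta> by (intro mult_right_mono) auto
    finally have "8 * \<delta> * degree h \<le> 8 * \<delta> * (3 / 4 * d)"
      using \<delta> by (intro mult_left_mono) auto
    then have contract: "8 * \<delta> * degree h + 2 * (\<delta> * d) \<le> 8 * \<delta> * d"
      by simp
    \<comment> \<open>With \<open>degree h = odd_steps d g\<close>, the difference splits as
      \<open>(reduced_tau h - 2 * degree h) + 2 * (degree h - d / 2)\<close>.\<close>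
    have "\<bar>real (reduced_tau g) - 2 * real d\<bar>
        \<le> \<bar>real (reduced_tau h) - 2 * real (degree h)\<bar> + 2 * \<bar>real (odd_steps d g) - d / 2\<bar>"
      unfolding taug degh by (simp add: abs_if)
    also have "\<dots> \<le> (8 * \<delta> * degree h + (real K)\<^sup>2) + 2 * (\<delta> * d)"
      by (intro add_mono mult_left_mono IH dev) simp
    also have "\<dots> \<le> 8 * \<delta> * d + (real K)\<^sup>2"
      using contract by simp
    finally show ?thesis .
  qed
  then show ?case by (simp only: d_def g_def)
qed

section \<open>Averaging and the limit for the reduced map\<close>

text \<open>Exceptional polynomials contribute at most the crude error \<open>n^2\<close> each,
  weighted by their small proportion.\<close>

lemma mean_reduced_tau_bound:
  assumes \<delta>: "0 < \<delta>" "\<delta> \<le> 1 / 4"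
  shows "\<bar>(\<Sum>f\<in>polys_of_degree n. real (reduced_tau f)) / 2 ^ n - 2 * real n\<bar>
    \<le> 8 * \<delta> * n + (real K)\<^sup>2
      + (real n)\<^sup>2 * (2 * (real n * (real n + 1) + 1) * (real n + 1) * exp (- \<delta>\<^sup>2) ^ K)"
    (is "_ \<le> ?a + ?c")
proof -
  let ?D = "polys_of_degree n" and ?E = "exceptional \<delta> K n"
  let ?x = "\<lambda>f. real (reduced_tau f) - 2 * real n"
  let ?p = "2 * (real n * (real n + 1) + 1) * (real n + 1) * exp (- \<delta>\<^sup>2) ^ K"
  have fin: "finite ?D" by (rule finite_polys_of_degree)
  have sub: "?E \<subseteq> ?D" by (auto simp: exceptional_def)
  have a0: "0 \<le> ?a" using \<delta> by simp
  have pointwise: "\<bar>?x f\<bar> \<le> ?a + (if f \<in> ?E then (real n)\<^sup>2 else 0)" if f: "f \<in> ?D" for f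
  proof (cases "f \<in> ?E")
    case True
    then show ?thesis
      using abs_reduced_tau_le [of f] f a0 by (simp add: polys_of_degree_def)
  next
    case False
    then show ?thesis
      using reduced_tau_iterate_bound [OF f False \<delta>, of 0] f by (simp add: polys_of_degree_def)
  qed
  have "(\<Sum>f\<in>?D. real (reduced_tau f)) / 2 ^ n - 2 * real n = (\<Sum>f\<in>?D. ?x f) / 2 ^ n"
    by (simp add: sum_subtractf card_polys_of_degree diff_divide_distrib)
  also have "\<bar>\<dots>\<bar> \<le> (\<Sum>f\<in>?D. \<bar>?x f\<bar>) / 2 ^ n"
    by (simp add: divide_right_mono sum_abs)
  also have "\<dots> \<le> (\<Sum>f\<in>?D. ?a + (if f \<in> ?E then (real n)\<^sup>2 else 0)) / 2 ^ n"
    by (intro divide_right_mono sum_mono pointwise) auto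
  also have "(\<Sum>f\<in>?D. ?a + (if f \<in> ?E then (real n)\<^sup>2 else 0))
      = 2 ^ n * ?a + (real n)\<^sup>2 * real (card ?E)"
    using sub fin by (simp add: sum.distrib card_polys_of_degree sum.If_cases Int_absorb1)
  also have "\<dots> / 2 ^ n \<le> (2 ^ n * ?a + (real n)\<^sup>2 * (2 ^ n * ?p)) / 2 ^ n"
    using \<delta> by (intro divide_right_mono add_left_mono mult_left_mono card_exceptional) auto
  also have "\<dots> = ?a + ?c"
    by (simp add: field_simps)
  finally show ?thesis .
qed

lemma mean_reduced_tau_limit:
  "(\<lambda>n. ((\<Sum>f\<in>polys_of_degree n. real (reduced_tau f)) / 2 ^ n) / real n) \<longlonglongrightarrow> 2"
proof (rule tendstoI)
  fix \<epsilon> :: real assume "\<epsilon> > 0"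
  define \<delta> where "\<delta> = min (1 / 4) (\<epsilon> / 16)"
  have \<delta>: "0 < \<delta>" "\<delta> \<le> 1 / 4" "8 * \<delta> \<le> \<epsilon> / 2"
    using \<open>\<epsilon> > 0\<close> by (auto simp: \<delta>_def)
  define q where "q = \<delta>\<^sup>2"
  have "q > 0" using \<delta> by (simp add: q_def)
  \<comment> \<open>The threshold \<open>K\<close> is about \<open>n powr (1 / 3)\<close>: the
    exponent is below 1/2, so \<open>K^2\<close> is o(n), yet \<open>exp (- q * K)\<close> still
    beats every power of n.\<close>
  define err where "err n = ((real n powr (1 / 3) + 1)\<^sup>2
      + (real n)\<^sup>2 * (2 * (real n * (real n + 1) + 1) * (real n + 1) * exp (- q * real n powr (1 / 3)))) / real n"
    for n :: nat
  have "err \<longlonglongrightarrow> 0"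
    unfolding err_def using \<open>q > 0\<close> by real_asymp
  then have "\<forall>\<^sub>F n in sequentially. err n < \<epsilon> / 2"
    using \<open>\<epsilon> > 0\<close> by (intro order_tendstoD) auto
  then show "\<forall>\<^sub>F n in sequentially. dist (((\<Sum>f\<in>polys_of_degree n. real (reduced_tau f)) / 2 ^ n) / real n) 2 < \<epsilon>"
    using eventually_gt_at_top [of 0]
  proof eventually_elim
    case (elim n)
    define S where "S = (\<Sum>f\<in>polys_of_degree n. real (reduced_tau f)) / 2 ^ n"
    define r where "r = real n powr (1 / 3)"
    define K where "K = nat \<lceil>r\<rceil>"
    have r0: "r \<ge> 0" by (simp add: r_def)
    have K: "r \<le> real K" "real K \<le> r + 1"
      using r0 unfolding K_def by linarith+
    have "(real K)\<^sup>2 \<le> (r + 1)\<^sup>2"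
      using K by (intro power_mono) auto
    moreover have "exp (- \<delta>\<^sup>2) ^ K \<le> exp (- q * r)"
      using K(1) \<open>q > 0\<close> by (simp add: exp_of_nat_mult [symmetric] q_def)
    then have "(real n)\<^sup>2 * (2 * (real n * (real n + 1) + 1) * (real n + 1) * exp (- \<delta>\<^sup>2) ^ K)
        \<le> (real n)\<^sup>2 * (2 * (real n * (real n + 1) + 1) * (real n + 1) * exp (- q * r))"
      by (intro mult_left_mono) auto
    moreover have "err n * n = (r + 1)\<^sup>2
        + (real n)\<^sup>2 * (2 * (real n * (real n + 1) + 1) * (real n + 1) * exp (- q * r))"
      using elim(2) by (simp add: err_def r_def)
    ultimately have "\<bar>S - 2 * real n\<bar> \<le> 8 * \<delta> * n + err n * n"
      using mean_reduced_tau_bound [OF \<delta>(1,2), of n K] unfolding S_def by linarith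
    also have "\<dots> = (8 * \<delta> + err n) * n" by (simp add: algebra_simps)
    also have "\<dots> < \<epsilon> * n"
      using elim \<delta>(3) by (intro mult_strict_right_mono) auto
    finally have "\<bar>S - 2 * real n\<bar> / n < \<epsilon>"
      using elim(2) by (simp add: field_simps)
    moreover have "\<bar>S - 2 * real n\<bar> / n = \<bar>S / n - 2\<bar>"
    proof -
      have "S / n - 2 = (S - 2 * real n) / n"
        using elim(2) by (simp add: diff_divide_distrib)
      then show ?thesis by simp
    qed
    ultimately show ?case by (simp add: dist_real_def S_def)
  qed
qed

section \<open>Transfer to \<open>T\<close>\<close>

lemma pcompose_linear_self: "([:1, 1:] :: bit poly) \<circ>\<^sub>p [:1, 1:] = [:0, 1:]"
  by (simp add: pcompose_pCons)

lemma pcompose_linear_twice: "(f \<circ>\<^sub>p [:1, 1:]) \<circ>\<^sub>p [:1, 1:] = (f :: bit poly)"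
  by (simp only: pcompose_assoc [symmetric] pcompose_linear_self pcompose_idR)

text \<open>The substitution exchanges X and \<open>X + 1\<close>, so the value at 1 becomes the
  constant coefficient and division by \<open>X + 1\<close> becomes division by X.\<close>

lemma pcompose_T: "T f \<circ>\<^sub>p [:1, 1:] = reduced_collatz (f \<circ>\<^sub>p [:1, 1:])"
proof -
  let ?g = "f \<circ>\<^sub>p [:1, 1:]"
  have par: "coeff ?g 0 = poly f 1"
    by (simp add: poly_0_coeff_0 [symmetric] poly_pcompose)
  have X: "([:0, 1:] :: bit poly) \<circ>\<^sub>p [:1, 1:] = [:1, 1:]"
    by (simp add: pcompose_pCons)
  have nz: "([:1, 1:] :: bit poly) \<noteq> 0" by simp
  have root: "[:1, 1:] dvd p" if "poly p 1 = 0" for p :: "bit poly"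
    using that poly_eq_0_iff_dvd [of p 1] by simp
  show ?thesis
  proof (cases "poly f 1 = 0")
    case True
    then obtain q where q: "f = [:1, 1:] * q" using root by blast
    have "T f = q"
      using nonzero_mult_div_cancel_left [OF nz, of q] True
      by (simp only: T_def simp_thms if_True flip: q)
    moreover have "?g = [:0, 1:] * (q \<circ>\<^sub>p [:1, 1:])"
      by (simp only: q pcompose_mult pcompose_linear_self)
    then have "?g = pCons 0 (q \<circ>\<^sub>p [:1, 1:])" by simp
    ultimately show ?thesis by (simp only: reduced_collatz_even)
  next
    case False
    then have "poly ([:0, 1:] * f + 1) 1 = 0" by simp
    then obtain q where q: "[:0, 1:] * f + 1 = [:1, 1:] * q" using root by blast
    have "T f = q"
      using nonzero_mult_div_cancel_left [OF nz, of q] by (simp only: T_def False if_False q)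
    moreover have "([:0, 1:] * f + 1) \<circ>\<^sub>p [:1, 1:] = [:0, 1:] * (q \<circ>\<^sub>p [:1, 1:])"
      by (simp only: q pcompose_mult pcompose_linear_self)
    then have "[:1, 1:] * ?g + 1 = pCons 0 (q \<circ>\<^sub>p [:1, 1:])"
      by (simp only: pcompose_add pcompose_mult X pcompose_1) simp
    then have "poly_shift 1 ([:1, 1:] * ?g + 1) = q \<circ>\<^sub>p [:1, 1:]"
      by (simp only:) simp
    \<comment> \<open>The added 1 affects only the coefficient that the shift drops.\<close>
    then have "poly_shift 1 ([:1, 1:] * ?g) = q \<circ>\<^sub>p [:1, 1:]"
      by (simp only: poly_shift_add poly_shift_1) simp
    moreover have "coeff ?g 0 \<noteq> 0" using par False by simp
    ultimately show ?thesis by (simp only: reduced_collatz_def if_False)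
  qed
qed

lemma tau_eq_reduced_tau: "tau f = reduced_tau (f \<circ>\<^sub>p [:1, 1:])"
proof -
  have "(reduced_collatz ^^ k) (f \<circ>\<^sub>p [:1, 1:]) = (T ^^ k) f \<circ>\<^sub>p [:1, 1:]" for k
    by (induction k) (simp_all only: funpow.simps o_apply id_apply pcompose_T)
  moreover have "g \<circ>\<^sub>p [:1, 1:] = 1 \<longleftrightarrow> g = 1" for g :: "bit poly"
    using pcompose_linear_twice [of g] pcompose_1 by metis
  ultimately show ?thesis
    by (simp only: tau_def stopping_time_def)
qed

lemma rho_eq_mean_reduced_tau: "rho n = (\<Sum>f\<in>polys_of_degree n. real (reduced_tau f)) / 2 ^ n"
proof -
  let ?c = "\<lambda>f :: bit poly. f \<circ>\<^sub>p [:1, 1:]"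
  have mem: "?c f \<in> polys_of_degree n" if "f \<in> polys_of_degree n" for f
  proof -
    have "?c f \<noteq> 0"
      using that pcompose_linear_twice [of f] by (auto simp: polys_of_degree_def)
    moreover have "degree (?c f) = degree f"
      by (simp add: degree_pcompose)
    ultimately show ?thesis using that by (simp add: polys_of_degree_def)
  qed
  have "bij_betw ?c (polys_of_degree n) (polys_of_degree n)"
    by (rule bij_betw_byWitness [where f' = ?c]) (auto simp: pcompose_linear_twice mem)
  then have "(\<Sum>f\<in>polys_of_degree n. real (reduced_tau (?c f))) = (\<Sum>f\<in>polys_of_degree n. real (reduced_tau f))"
    by (rule sum.reindex_bij_betw)
  then show ?thesis
    by (simp only: rho_def tau_eq_reduced_tau polys_of_degree_def)
qed

section \<open>Comparison with \<open>T0\<close> and conclusion\<close>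

lemma tau0_eq_stopping_time: "tau0 = stopping_time T0 1"
  by (simp add: fun_eq_iff tau0_def stopping_time_def)

lemma T0_even: "T0 (pCons 0 p) = p"
proof -
  have "pCons 0 p = [:0, 1:] * p" by simp
  then have "pCons 0 p div [:0, 1:] = p"
    by (metis nonzero_mult_div_cancel_left pCons_eq_0_iff zero_neq_one)
  then show ?thesis by (simp add: T0_def)
qed

lemma T0_odd: "T0 (pCons 1 p) = pCons 0 (reduced_collatz (pCons 1 p))"
proof -
  have "T0 (pCons 1 p) = [:1, 1:] * pCons 1 p + 1"
    by (simp add: T0_def)
  also have "\<dots> = pCons 0 (1 + [:1, 1:] * p)"
    by (simp add: one_pCons)
  finally show ?thesis by (simp only: reduced_collatz_odd)
qed

text \<open>An even step of the reduced map is one step of \<open>T0\<close> and lowers the degree by one; an odd step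
  is two steps of \<open>T0\<close> and preserves the degree.\<close>

lemma tau0_add_degree:
  assumes "f \<noteq> 0"
  shows "(\<exists>k. (T0 ^^ k) f = 1) \<and> tau0 f + degree f = 2 * reduced_tau f"
  using assms
\<comment> \<open>The degree cannot serve as induction measure, as odd steps preserve it. Going back
  one reduced step, \<open>tau0 f + degree f\<close> grows by 1 + 1 in the even case and by 2 + 0 in
  the odd case.\<close>
proof (induction "reduced_tau f" arbitrary: f rule: less_induct)
  case less
  show ?case
  proof (cases "f = 1")
    case True
    have "(T0 ^^ 0) f = 1" using True by simp
    then show ?thesis using True by (intro conjI exI [of _ 0]) (simp_all add: tau0_eq_stopping_time)
  next
    case False
    let ?g = "reduced_collatz f"
    have gnz: "?g \<noteq> 0" using less.prems by (rule reduced_collatz_nonzero)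
    have tf: "reduced_tau f = Suc (reduced_tau ?g)"
      using reduced_collatz_reaches_1 [OF gnz] False by (intro stopping_time_Suc) auto
    then have IH: "\<exists>k. (T0 ^^ k) ?g = 1" "tau0 ?g + degree ?g = 2 * reduced_tau ?g"
      using less.hyps [of ?g] gnz by auto
    note deg = degree_reduced_collatz [OF less.prems]
    show ?thesis
    proof (cases f rule: bit_poly_cases)
      case (even p)
      then have T: "T0 f = ?g" by (simp only: T0_even reduced_collatz_even)
      have "tau0 f = Suc (tau0 ?g)"
        using stopping_time_Suc [of T0 f 1] IH(1) False by (simp add: tau0_eq_stopping_time T)
      moreover obtain k where "(T0 ^^ k) ?g = 1" using IH(1) by blast
      then have "(T0 ^^ Suc k) f = 1" by (simp only: funpow_Suc_right o_apply T)
      moreover have "degree ?g + 1 = degree f" using deg even by simp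
      ultimately show ?thesis using IH(2) tf by (intro conjI exI [of _ "Suc k"]) simp_all
    next
      case (odd p)
      then have T: "T0 f = pCons 0 ?g" by (simp only: T0_odd)
      have T2: "T0 (pCons 0 ?g) = ?g" by (rule T0_even)
      obtain k where k: "(T0 ^^ k) ?g = 1" using IH(1) by blast
      then have k1: "(T0 ^^ Suc k) (T0 f) = 1" by (simp only: funpow_Suc_right o_apply T T2)
      then have k2: "(T0 ^^ Suc (Suc k)) f = 1" by (subst funpow_Suc_right) (simp only: o_apply)
      have "tau0 f = Suc (tau0 (T0 f))"
        unfolding tau0_eq_stopping_time using k1 False by (intro stopping_time_Suc) blast+
      also have "tau0 (T0 f) = Suc (tau0 ?g)"
      proof -
        \<comment> \<open>The intermediate value is even, so \<open>T0\<close> cannot stop halfway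
          through an odd reduced step.\<close>
        have "pCons 0 ?g \<noteq> 1" by (simp add: one_pCons)
        then show ?thesis
          using stopping_time_Suc [of T0 "pCons 0 ?g" 1] k by (auto simp: tau0_eq_stopping_time T T2)
      qed
      finally have "tau0 f = Suc (Suc (tau0 ?g))" .
      moreover have "degree ?g = degree f" using deg odd by simp
      ultimately show ?thesis using IH(2) tf k2 by (intro conjI exI [of _ "Suc (Suc k)"]) simp_all
    qed
  qed
qed

lemma rho0_eq: "rho0 n = 2 * rho n - real n"
proof -
  have "real (tau0 f) = 2 * real (reduced_tau f) - real n" if "f \<in> polys_of_degree n" for f
    using tau0_add_degree [of f] that by (simp add: polys_of_degree_def flip: of_nat_add of_nat_mult)
  then have "(\<Sum>f\<in>polys_of_degree n. real (tau0 f)) = (\<Sum>f\<in>polys_of_degree n. 2 * real (reduced_tau f) - real n)"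
    by (rule sum.cong [OF refl])
  also have "\<dots> = 2 * (\<Sum>f\<in>polys_of_degree n. real (reduced_tau f)) - 2 ^ n * real n"
    by (simp add: sum_subtractf card_polys_of_degree sum_distrib_left)
  finally show ?thesis
    by (simp add: rho_eq_mean_reduced_tau rho0_def polys_of_degree_def diff_divide_distrib)
qed

theorem theorem2p14:
  shows "(\<lambda>n. rho n / real n) \<longlonglongrightarrow> 2 \<and> (\<lambda>n. rho0 n / real n) \<longlonglongrightarrow> 3"
proof
  show rho: "(\<lambda>n. rho n / real n) \<longlonglongrightarrow> 2"
    using mean_reduced_tau_limit by (simp only: rho_eq_mean_reduced_tau)
  have "(\<lambda>n. 2 * (rho n / real n) - 1) \<longlonglongrightarrow> 2 * 2 - 1"
    by (intro tendsto_intros rho)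
  \<comment> \<open>At \<open>n = 0\<close> division by zero would give 0 on the right and -1 on the
    left, so the identity is claimed only eventually.\<close>
  moreover have "\<forall>\<^sub>F n in sequentially. 2 * (rho n / real n) - 1 = rho0 n / real n"
    using eventually_gt_at_top [of 0] by eventually_elim (simp add: rho0_eq field_simps)
  ultimately show "(\<lambda>n. rho0 n / real n) \<longlonglongrightarrow> 3"
    using Lim_transform_eventually by fastforce
qed

end
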